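(* Let $M,N$ be non-negative integers and let $q,a,b,c,b',c',d$ be nonzero complex numbers with $|q|<1$, such that no denominator appearing below vanishes. Then $$\sum_{l=0}^{M}\sum_{n=0}^{N}\frac{(b',\,qa/d;q)_{n+l}}{(qa,\,b'c'q^{-M}/a;q)_{n+l}}\cdot\frac{(c',q^{-M};q)_l}{(q,\,qa/d;q)_l}$$ $$\times\frac{\left(q\sqrt{b'},-q\sqrt{b'},b,c,\frac{ab'q^{1+N}}{bc},\frac{b'c'}{a},\frac{b'q^{-M}}{a},q^{-N};q\right)_n}{\left(q,\sqrt{b'},-\sqrt{b'},\frac{qb'}{b},\frac{qb'}{c},\frac{bcq^{-N}}{a},b'q^{1+N},\frac{qa}{d};q\right)_n}\,q^{n+l}$$ $$=\frac{\left(\frac{qa}{b'},\frac{qa}{c'};q\right)_M}{\left(qa,\frac{qa}{b'c'};q\right)_M}\cdot\frac{\left(qb',\frac{qa}{b},\frac{qa}{c},\frac{qb'}{bc};q\right)_N}{\left(qa,\frac{qb'}{b},\frac{qb'}{c},\frac{qa}{bc};q\right)_N}\;{}_{10}W_9\!\left(a;d,b,c,c',\frac{ab'q^{1+N}}{bc},q^{-M},q^{-N};q,\frac{a^2q^{2+M}}{b'c'd}\right).$$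
   Context: Notation: $(x;q)_n=\prod_{j=0}^{n-1}(1-xq^j)$ for integers $n\ge0$, and $(x_1,\dots,x_r;q)_n=\prod_{i}(x_i;q)_n$. The very-well-poised series is $${}_{r+1}W_r(a;a_1,\dots,a_{r-2};q,z)=\sum_{m\ge0}\frac{(a,q\sqrt a,-q\sqrt a,a_1,\dots,a_{r-2};q)_m}{(q,\sqrt a,-\sqrt a,qa/a_1,\dots,qa/a_{r-2};q)_m}z^m,$$ where square roots are fixed choices (so $\frac{(q\sqrt a,-q\sqrt a;q)_m}{(\sqrt a,-\sqrt a;q)_m}=\frac{1-aq^{2m}}{1-a}$). Here it terminates because $q^{-M}$ and $q^{-N}$ are among the parameters: all terms with $m>\min(M,N)$ are zero. *)

theory Defs
  imports Complex_Main
begin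

definition qpoch :: "complex \<Rightarrow> complex \<Rightarrow> nat \<Rightarrow> complex" where
  "qpoch x q n = (\<Prod>j<n. 1 - x * q ^ j)"

definition qpochs :: "complex list \<Rightarrow> complex \<Rightarrow> nat \<Rightarrow> complex" where
  "qpochs xs q n = (\<Prod>x\<leftarrow>xs. qpoch x q n)"

text \<open>
  The very-well-poised series \<open>W(a; ps; q, z)\<close>, whose index \<open>r + 1\<close> is \<open>length ps + 3\<close>.
  The argument \<open>s\<close> is the chosen square root of \<open>a\<close>, so users must supply \<open>s\<^sup>2 = a\<close>.
  When some \<open>q\<^sup>-\<^sup>M\<close> is among the parameters, the numerator vanishes for \<open>m > M\<close>; the
  corresponding summand is then \<open>0\<close> even if its denominator vanishes too, since \<open>0 / 0 = 0\<close>.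
\<close>

definition vwp_num :: "complex \<Rightarrow> complex \<Rightarrow> complex list \<Rightarrow> complex \<Rightarrow> nat \<Rightarrow> complex" where
  "vwp_num a s ps q m = qpochs ([a, q * s, - q * s] @ ps) q m"

definition vwp_den :: "complex \<Rightarrow> complex \<Rightarrow> complex list \<Rightarrow> complex \<Rightarrow> nat \<Rightarrow> complex" where
  "vwp_den a s ps q m = qpochs ([q, s, - s] @ map (\<lambda>p. q * a / p) ps) q m"

definition vwp_W :: "complex \<Rightarrow> complex \<Rightarrow> complex list \<Rightarrow> complex \<Rightarrow> complex \<Rightarrow> complex" where
  "vwp_W a s ps q z = (\<Sum>m. vwp_num a s ps q m / vwp_den a s ps q m * z ^ m)"

end

theory Submission
  imports Defs
begin

text \<open>
  The quotient \<open>(qa/d; q)\<^sub>n\<^sub>+\<^sub>l / ((qa/d; q)\<^sub>n (qa/d; q)\<^sub>l (qa; q)\<^sub>n\<^sub>+\<^sub>l)\<close> is, by a terminating \<open>\<^sub>6\<phi>\<^sub>5\<close> sum, a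
  combination over \<open>m \<le> min n l\<close> of products of a function of \<open>n\<close> and a function of \<open>l\<close>, with
  coefficients that carry all the dependence on \<open>d\<close>.  After interchanging the sums, for fixed \<open>m\<close> the
  sum over \<open>l\<close> is a \<open>q\<close>-Saalschuetz sum; the factors it produces turn the sum over \<open>n\<close> into Jackson's
  \<open>\<^sub>8\<phi>\<^sub>7\<close> sum with base \<open>b'q\<^sup>2\<^sup>m\<close>, and what remains is the \<open>m\<close>-th term of the \<open>\<^sub>1\<^sub>0W\<^sub>9\<close> series.
  All three summations are instances of one polynomial form of Jackson's sum.
\<close>

section \<open>Jackson's sum and its degenerations\<close>

text \<open>
  \<open>vwp B q k\<close> is \<open>(B, q\<surd>B, -q\<surd>B; q)\<^sub>k / (\<surd>B, -\<surd>B; q)\<^sub>k\<close> with the factor \<open>1 - B\<close> cancelled, so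
  that it is a polynomial in \<open>B\<close>.  The homogeneous \<open>hpoch x y q k\<close> equals \<open>x\<^sup>k (y/x; q)\<^sub>k\<close>, but it
  also covers \<open>x = 0\<close>, where \<open>hpoch 0 1 q k\<close> is \<open>(-1)\<^sup>k\<close> times \<open>q\<close> to the power \<open>k choose 2\<close>.
\<close>

definition vwp :: "complex \<Rightarrow> complex \<Rightarrow> nat \<Rightarrow> complex" where
  "vwp B q k = (if k = 0 then 1 else qpoch (q * B) q (k - 1) * (1 - B * q ^ (2 * k)))"

definition hpoch :: "complex \<Rightarrow> complex \<Rightarrow> complex \<Rightarrow> nat \<Rightarrow> complex" where
  "hpoch x y q k = (\<Prod>j<k. x - y * q ^ j)"

section \<open>Splitting and nonvanishing of q-shifted factorials\<close>

lemma qpoch_0 [simp]: "qpoch x q 0 = 1"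
  by (simp add: qpoch_def)

lemma qpoch_Suc: "qpoch x q (Suc n) = qpoch x q n * (1 - x * q ^ n)"
  by (simp add: qpoch_def)

lemma qpoch_add: "qpoch x q (m + n) = qpoch x q m * qpoch (x * q ^ m) q n"
  by (induction n) (simp_all add: qpoch_Suc power_add algebra_simps)

lemma qpoch_nonzero_mono: "qpoch x q n \<noteq> 0 \<Longrightarrow> m \<le> n \<Longrightarrow> qpoch x q m \<noteq> 0"
  using qpoch_add[of x q m "n - m"] by auto

lemma qpoch_nonzero_shift: "qpoch x q n \<noteq> 0 \<Longrightarrow> m + k \<le> n \<Longrightarrow> qpoch (x * q ^ m) q k \<noteq> 0"
  using qpoch_nonzero_mono[of x q n "m + k"] qpoch_add[of x q m k] by auto

lemma hpoch_0 [simp]: "hpoch x y q 0 = 1"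
  by (simp add: hpoch_def)

lemma hpoch_Suc: "hpoch x y q (Suc n) = hpoch x y q n * (x - y * q ^ n)"
  by (simp add: hpoch_def)

lemma vwp_0 [simp]: "vwp B q 0 = 1"
  by (simp add: vwp_def)

lemma vwp_Suc: "vwp B q (Suc k) = qpoch (B * q) q k * (1 - B * q ^ (2 * Suc k))"
  by (simp add: vwp_def mult.commute)

text \<open>
  Jackson's terminating very-well-poised sum with base \<open>B\<close> and free parameters \<open>Bq/C\<close>, \<open>1/p\<close>, \<open>1/r\<close>.
  With these parameters every term is defined at \<open>B = 0\<close> and at \<open>r = 0\<close>, where the sum becomes
  the \<open>q\<close>-Saalschuetz sum and the terminating \<open>\<^sub>6\<phi>\<^sub>5\<close> sum, respectively.
\<close>

lemma jackson_sum_generic: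
  fixes B C p r q :: complex
  assumes "qpoch q q N \<noteq> 0" "qpoch C q N \<noteq> 0" "qpoch (B*q*p) q N \<noteq> 0" "qpoch (B*q*r) q N \<noteq> 0"
    and "qpoch (B*q) q (2 * N) \<noteq> 0"
  shows "(\<Sum>k\<le>N. vwp B q k * (hpoch C (B*q) q k * hpoch p 1 q k * hpoch r 1 q k)
            / (qpoch q q k * qpoch C q k * qpoch (B*q*p) q k * qpoch (B*q*r) q k)
            * (qpoch (B*C*p*r) q (N + k) * qpoch (C*p*r) q (N - k)
               / (qpoch q q (N - k) * qpoch (B*q) q (N + k))))
       = qpoch (B*C*p*r) q N * qpoch (B*q*p*r) q N * qpoch (C*p) q N * qpoch (C*r) q N
            / (qpoch q q N * qpoch C q N * qpoch (B*q*p) q N * qpoch (B*q*r) q N)"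
  using assms
proof (induction N)
  case 0
  then show ?case by simp
next
  case (Suc N)
  define U where "U k = hpoch C (B*q) q k * hpoch p 1 q k * hpoch r 1 q k" for k
  define V where "V k = qpoch q q k * qpoch C q k * qpoch (B*q*p) q k * qpoch (B*q*r) q k" for k
  define W where "W = B*C*p*r"
  define t where "t N k = vwp B q k * U k / V k * (qpoch W q (N + k) * qpoch (C*p*r) q (N - k)
               / (qpoch q q (N - k) * qpoch (B*q) q (N + k)))" for N k
  define y where "y = q ^ N"
  \<comment> \<open>Since \<open>y = q^N\<close>, the quotient \<open>A' / A\<close> is the ratio of
    the claimed closed forms for \<open>N + 1\<close> and \<open>N\<close>.\<close>
  define A where "A = (1 - y*q) * (1 - C*y) * (1 - B*q*p*y) * (1 - B*q*r*y)"
  define A' where "A' = (1 - B*q*p*r*y) * (1 - C*p*y) * (1 - C*r*y) * (1 - B*C*p*r*y)"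
  \<comment> \<open>The WZ certificate of the recurrence \<open>A * S (N + 1) = A' * S N\<close> for the sums \<open>S\<close>; its shape is read
      off from \<open>A * t (N + 1) 0 - A' * t N 0\<close>, which factors completely.\<close>
  define G where "G k = - (q ^ (N - k) * (1 - q*W*y^2) * U (Suc k) * qpoch (B*q) q k / V k
      * (qpoch W q (Suc (N + k)) * qpoch (C*p*r) q (N - k)
         / (qpoch q q (N - k) * qpoch (B*q) q (Suc (N + k)))))" for k
  have nz: "qpoch q q k \<noteq> 0" "qpoch C q k \<noteq> 0" "qpoch (B*q*p) q k \<noteq> 0" "qpoch (B*q*r) q k \<noteq> 0"
    if "k \<le> Suc N" for k
    using Suc.prems qpoch_nonzero_mono[OF _ that] by blast+
  have V0: "V k \<noteq> 0" if "k \<le> Suc N" for k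
    using nz[OF that] by (simp add: V_def)
  have Bnz: "qpoch (B*q) q k \<noteq> 0" if "k \<le> 2 * Suc N" for k
    using Suc.prems(5) that by (rule qpoch_nonzero_mono)
  have A: "V (Suc N) = V N * A"
    by (simp add: V_def qpoch_Suc A_def y_def mult_ac)
  have A0: "A \<noteq> 0"
    using A V0[of "Suc N"] by auto
  have Bf: "1 - B*q*q^k \<noteq> 0" if "k < 2 * Suc N" for k
    using Bnz[of "Suc k"] that by (simp add: qpoch_Suc)
  have qf: "1 - q*q^k \<noteq> 0" if "k < Suc N" for k
    using nz(1)[of "Suc k"] that by (simp add: qpoch_Suc)
  \<comment> \<open>Termwise this says
    \<open>A * t (Suc N) k - A' * t N k = G k - G (k - 1)\<close>, with the value before
    \<open>G 0\<close> read as 0; hence index 0 is checked separately.\<close>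
  have telescope: "(\<Sum>k\<le>K. A * t (Suc N) k - A' * t N k) = G K" if "K \<le> N" for K
    using that
  proof (induction K)
    case 0
    have n: "1 - B*q*y \<noteq> 0" "1 - q*y \<noteq> 0" "qpoch q q N \<noteq> 0" "qpoch (B*q) q N \<noteq> 0"
      using Bf[of N] qf[of N] nz(1)[of N] Bnz[of N] by (auto simp: y_def)
    define K where "K = qpoch W q N * qpoch (C*p*r) q N / (qpoch q q N * qpoch (B*q) q N)"
    define D where "D = (1 - B*q*y) * (1 - q*y)"
    have D0: "D \<noteq> 0" using n by (simp add: D_def)
    have 1: "t N 0 = K" by (simp add: t_def U_def V_def K_def)
    have 2: "t (Suc N) 0 * D = K * (1 - W*y) * (1 - C*p*r*y)"
      using n by (simp add: t_def U_def V_def K_def D_def qpoch_Suc flip: y_def)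
    have 3: "G 0 * D = - (y * (1 - q*W*y^2) * (C - B*q) * (p - 1) * (r - 1) * K * (1 - W*y) * (1 - q*y))"
      using n by (simp add: G_def U_def V_def K_def D_def qpoch_Suc hpoch_Suc flip: y_def)
    have "(A * t (Suc N) 0 - A' * t N 0) * D = A * (t (Suc N) 0 * D) - A' * t N 0 * D"
      by (simp add: algebra_simps)
    also have "\<dots> = G 0 * D"
      unfolding 1 2 3 unfolding A_def A'_def W_def D_def by algebra
    finally show ?case using D0 by simp
  next
    case (Suc k')
    define k where "k = Suc k'"
    obtain i where N: "N = k + i"
      using Suc.prems k_def le_Suc_ex by blast
    have i: "N - k = i" "N - k' = Suc i" "Suc N - k = Suc i" "N + k' = k + k' + i"
      using N k_def by auto
    have ii: "Suc (N + k') = N + k"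
      using k_def by simp
    define x z where "x = q ^ k" and "z = q ^ i"
    have xq: "x = q * q ^ k'" by (simp add: x_def k_def)
    have y: "y = x * z" by (simp add: y_def x_def z_def N power_add)
    have n: "1 - B*q*(y*x) \<noteq> 0" "1 - q*z \<noteq> 0" "qpoch q q i \<noteq> 0" "qpoch (B*q) q (N + k) \<noteq> 0"
        "V k \<noteq> 0" "V k' \<noteq> 0"
      using Bf[of "N + k"] qf[of i] nz(1)[of i] Bnz[of "N + k"] V0[of k] V0[of k'] Suc.prems
      by (auto simp: y_def x_def z_def N k_def power_add mult_ac)
    \<comment> \<open>The extra factor \<open>q\<close> turns \<open>1 - C q^k'\<close> into
      \<open>q - C x\<close>, so that no quotient \<open>x / q\<close> occurs.\<close>
    have Vk: "V k * q = V k' * ((1 - x) * (q - C*x) * (1 - B*p*x) * (1 - B*r*x))"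
      unfolding V_def k_def qpoch_Suc xq by (simp add: algebra_simps)
    \<comment> \<open>All four terms are \<open>K\<close> times a rational function whose
      denominator divides \<open>D\<close>. After multiplication by \<open>D\<close> a polynomial
      identity remains, which \<open>algebra\<close> decides.\<close>
    define K where "K = U k * qpoch (B*q) q k' * qpoch W q (N + k) * qpoch (C*p*r) q i
       / (V k * qpoch q q i * qpoch (B*q) q (N + k))"
    define D where "D = (1 - B*q*(y*x)) * (1 - q*z)"
    have D0: "D \<noteq> 0" using n by (simp add: D_def)
    have vw: "vwp B q k = qpoch (B*q) q k' * (1 - B*x^2)"
      unfolding k_def vwp_Suc x_def power_even_eq ..
    have Suc_add: "Suc N + k = Suc (N + k)" by simp
    have yx: "q ^ (N + k) = y * x" by (simp add: y_def x_def power_add)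
    have 1: "t N k = K * (1 - B*x^2)"
      unfolding t_def K_def vw i by (simp add: mult_ac)
    have 2: "t (Suc N) k * D = K * (1 - B*x^2) * (1 - W*(y*x)) * (1 - C*p*r*z)"
      using n unfolding t_def K_def vw i D_def Suc_add qpoch_Suc yx z_def[symmetric]
      by (simp add: divide_simps)
    have 3: "G k * D = - (z * (1 - q*W*y^2) * ((C - B*q*x) * (p - x) * (r - x)) * (1 - B*x) * K * (1 - W*(y*x)) * (1 - q*z))"
    proof -
      have "qpoch (B*q) q k = qpoch (B*q) q k' * (1 - B*x)"
        by (simp add: k_def qpoch_Suc x_def)
      moreover have "U (Suc k) = U k * ((C - B*q*x) * (p - x) * (r - x))"
        by (simp add: U_def hpoch_Suc x_def)
      ultimately show ?thesis
        using n unfolding G_def K_def i D_def Suc_add qpoch_Suc yx z_def[symmetric]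
        by (simp add: divide_simps)
    qed
    have 4: "G k' * D = - (z * (1 - q*W*y^2) * ((1 - x) * (q - C*x) * (1 - B*p*x) * (1 - B*r*x))
        * K * (1 - C*p*r*z) * (1 - B*q*(y*x)))"
    proof -
      define J where "J = (1 - q*W*y^2) * U k * qpoch (B*q) q k' *
           (qpoch W q (N + k) * qpoch (C*p*r) q i / (qpoch q q i * qpoch (B*q) q (N + k)))"
      have "G k' * D = - (z * J * (q / V k') * (1 - C*p*r*z) * (1 - B*q*(y*x)))"
        using n unfolding G_def J_def i(2) ii D_def k_def[symmetric]
        by (simp add: qpoch_Suc flip: z_def) (simp add: divide_simps)
      moreover have "q / V k' = ((1 - x) * (q - C*x) * (1 - B*p*x) * (1 - B*r*x)) / V k"
        using Vk n by (simp add: divide_simps mult.commute)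
      ultimately show ?thesis by (simp add: J_def K_def mult_ac)
    qed
    have "(\<Sum>k\<le>Suc k'. A * t (Suc N) k - A' * t N k) * D
        = G k' * D + A * (t (Suc N) k * D) - A' * t N k * D"
      using Suc.IH Suc.prems by (simp add: k_def algebra_simps)
    also have "\<dots> = G k * D"
      unfolding 1 2 3 4 unfolding A_def A'_def W_def D_def y
      by algebra
    finally show ?case using D0 by (simp add: k_def)
  qed
  \<comment> \<open>The index \<open>k = N + 1\<close> occurs only in the sum for
    \<open>N + 1\<close>; in \<open>t N\<close> the truncated difference \<open>N - k\<close> would
    produce a spurious term. Its contribution cancels the boundary value \<open>G N\<close>.\<close>
  have last: "A * t (Suc N) (Suc N) = - G N"
  proof -
    have "vwp B q (Suc N) = qpoch (B*q) q N * (1 - B*q*q^(Suc (N + N)))"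
      unfolding vwp_Suc by (simp add: mult_2)
    moreover have "1 - B*q*q^(Suc (N + N)) \<noteq> 0"
      using Bf[of "Suc (N + N)"] by simp
    moreover have "y^2 = q ^ (N + N)"
      by (simp add: y_def power_add power2_eq_square)
    moreover have "Suc N + Suc N = Suc (Suc (N + N))" by simp
    ultimately show ?thesis
      using A0 V0[of N] Bnz[of "Suc (N + N)"]
      unfolding t_def G_def A
      by (simp add: qpoch_Suc[of _ _ "Suc (N+N)"])
  qed
  have IH: "(\<Sum>k\<le>N. t N k) = qpoch W q N * qpoch (B*q*p*r) q N * qpoch (C*p) q N * qpoch (C*r) q N / V N"
    using Suc.IH nz[of N] Bnz[of "2*N"] by (simp add: t_def U_def V_def W_def)
  have "A * (\<Sum>k\<le>Suc N. t (Suc N) k) - A' * (\<Sum>k\<le>N. t N k)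
      = (\<Sum>k\<le>N. A * t (Suc N) k - A' * t N k) + A * t (Suc N) (Suc N)"
    by (simp add: sum_subtractf sum_distrib_left algebra_simps)
  also have "\<dots> = 0" by (simp add: telescope last)
  finally have "(\<Sum>k\<le>Suc N. t (Suc N) k) = A' * (\<Sum>k\<le>N. t N k) / A"
    using A0 by (simp add: field_simps)
  also have "\<dots> = qpoch W q (Suc N) * qpoch (B*q*p*r) q (Suc N) * qpoch (C*p) q (Suc N) * qpoch (C*r) q (Suc N) / V (Suc N)"
    unfolding IH A by (simp add: qpoch_Suc A'_def W_def y_def mult_ac)
  finally show ?case by (simp add: t_def U_def V_def W_def)
qed

section \<open>Specializations at zero and continuity in the base\<close>

lemma qpoch_zero_left [simp]: "qpoch 0 q n = 1"
  by (simp add: qpoch_def)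

lemma vwp_zero_left [simp]: "vwp 0 q n = 1"
  by (simp add: vwp_def)

lemma hpoch_eq_qpoch: "x \<noteq> 0 \<Longrightarrow> hpoch x y q n = x ^ n * qpoch (y / x) q n"
  by (induction n) (simp_all add: qpoch_Suc hpoch_Suc field_simps)

lemma hpoch_0_1_nonzero: "q \<noteq> 0 \<Longrightarrow> hpoch 0 1 q n \<noteq> 0"
  by (simp add: hpoch_def)

text \<open>Each factor vanishes for at most one value of \<open>B\<close>; it is constantly 1 when
  \<open>s q^n = 0\<close>.\<close>

lemma eventually_qpoch_nonzero: "eventually (\<lambda>B. qpoch (B * s) q n \<noteq> 0) (at B0)"
proof (induction n)
  case 0
  then show ?case by simp
next
  case (Suc n)
  have "eventually (\<lambda>B. 1 - B * s * q ^ n \<noteq> 0) (at B0)"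
  proof (cases "s * q ^ n = 0")
    case False
    have "eventually (\<lambda>B. B \<noteq> 1 / (s * q ^ n)) (at B0)"
      by (rule eventually_neq_at_within)
    then show ?thesis
      by (rule eventually_mono) (use False in \<open>auto simp: field_simps\<close>)
  next
    case True
    then show ?thesis
      by (simp only: mult.assoc) simp
  qed
  with Suc show ?case
    by eventually_elim (simp add: qpoch_Suc)
qed

lemma isCont_qpoch [continuous_intros]:
  "isCont f z \<Longrightarrow> isCont (\<lambda>z. qpoch (f z) q n) z"
  unfolding qpoch_def by (intro continuous_intros)

lemma isCont_hpoch [continuous_intros]:
  "isCont f z \<Longrightarrow> isCont (\<lambda>z. hpoch x (f z) q n) z"
  unfolding hpoch_def by (intro continuous_intros)

lemma isCont_vwp [continuous_intros]: "isCont (\<lambda>z. vwp z q n) z"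
  unfolding vwp_def by (cases "n = 0") (auto intro!: continuous_intros)

text \<open>
  Dividing the generic form by \<open>(BCpr; q)\<^sub>N\<close> and multiplying by \<open>(Bq; q)\<^sub>N\<close> is legitimate for
  all \<open>B\<close> outside a finite set; the exceptional \<open>B\<close> follow by continuity.
\<close>

lemma jackson_sum:
  fixes B C p r q :: complex
  assumes nz: "qpoch q q N \<noteq> 0" "qpoch C q N \<noteq> 0" "qpoch (B*q*p) q N \<noteq> 0" "qpoch (B*q*r) q N \<noteq> 0"
    "qpoch (B*q*q^N) q N \<noteq> 0"
  shows "(\<Sum>k\<le>N. vwp B q k * (hpoch C (B*q) q k * hpoch p 1 q k * hpoch r 1 q k)
            / (qpoch q q k * qpoch C q k * qpoch (B*q*p) q k * qpoch (B*q*r) q k)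
            * (qpoch (B*C*p*r*q^N) q k * qpoch (C*p*r) q (N - k)
               / (qpoch q q (N - k) * qpoch (B*q*q^N) q k)))
       = qpoch (B*q) q N * qpoch (B*q*p*r) q N * qpoch (C*p) q N * qpoch (C*r) q N
            / (qpoch q q N * qpoch C q N * qpoch (B*q*p) q N * qpoch (B*q*r) q N)"
    (is "?f B = ?g B")
proof -
  have "eventually (\<lambda>X. ?f X = ?g X) (at B)"
    using eventually_qpoch_nonzero[of "q*p" q N B] eventually_qpoch_nonzero[of "q*r" q N B]
      eventually_qpoch_nonzero[of q q "2 * N" B] eventually_qpoch_nonzero[of "C*p*r" q N B]
  proof eventually_elim
    case (elim X)
    have split: "qpoch (X*q) q (N + k) = qpoch (X*q) q N * qpoch (X*q*q^N) q k"
        "qpoch (X*C*p*r) q (N + k) = qpoch (X*C*p*r) q N * qpoch (X*C*p*r*q^N) q k" for k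
      by (rule qpoch_add)+
    have W: "qpoch (X*C*p*r) q N \<noteq> 0" "qpoch (X*q) q N \<noteq> 0"
      using elim qpoch_nonzero_mono[of "X*q" q "2*N" N] by (simp_all add: mult_ac)
    have "?f X = (qpoch (X*q) q N / qpoch (X*C*p*r) q N) * (\<Sum>k\<le>N. vwp X q k * (hpoch C (X*q) q k * hpoch p 1 q k * hpoch r 1 q k)
            / (qpoch q q k * qpoch C q k * qpoch (X*q*p) q k * qpoch (X*q*r) q k)
            * (qpoch (X*C*p*r) q (N + k) * qpoch (C*p*r) q (N - k)
               / (qpoch q q (N - k) * qpoch (X*q) q (N + k))))"
      unfolding sum_distrib_left split using W by (intro sum.cong refl) (simp add: mult_ac)
    also have "\<dots> = ?g X"
      using W elim nz by (subst jackson_sum_generic) (simp_all add: mult.assoc)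
    finally show ?case .
  qed
  moreover have "(?f \<longlongrightarrow> ?f B) (at B)"
  proof -
    have "qpoch q q k \<noteq> 0" "qpoch C q k \<noteq> 0" "qpoch (B*q*p) q k \<noteq> 0" "qpoch (B*q*r) q k \<noteq> 0"
        "qpoch (B*q*q^N) q k \<noteq> 0" if "k \<le> N" for k
      using nz qpoch_nonzero_mono[OF _ that] by blast+
    then have "isCont ?f B"
      by (intro continuous_intros) simp_all
    then show ?thesis
      by (rule isContD)
  qed
  moreover have "(?g \<longlongrightarrow> ?g B) (at B)"
    using nz by (intro isContD continuous_intros) simp_all
  ultimately show ?thesis
    using tendsto_unique[of "at B" ?g "?f B" "?g B"] tendsto_cong[of ?f ?g "at B"] by auto
qed

text \<open>Jackson's sum with base 0, \<open>C = A D u\<close>, \<open>p = 1/A\<close> and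
  \<open>r = 1/D\<close>, so that \<open>C p r = u\<close>. The usual factor
  \<open>(q^(-N); q)_k\<close> appears in reversed form, through the products of length
  \<open>N - k\<close>.\<close>

lemma q_saalschuetz_sum:
  fixes A D u q :: complex
  assumes "A \<noteq> 0" "D \<noteq> 0" "qpoch q q N \<noteq> 0" "qpoch (A*D*u) q N \<noteq> 0"
  shows "(\<Sum>k\<le>N. qpoch A q k * qpoch D q k * u ^ k * qpoch u q (N - k)
            / (qpoch q q k * qpoch (A*D*u) q k * qpoch q q (N - k)))
       = qpoch (A*u) q N * qpoch (D*u) q N / (qpoch q q N * qpoch (A*D*u) q N)"
proof -
  have "hpoch (A*D*u) 0 q k = (A*D*u) ^ k" for k
    by (simp add: hpoch_def)
  then show ?thesis
    using assms jackson_sum_generic[of q N "A*D*u" 0 "1/A" "1/D"]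
    by (simp add: hpoch_eq_qpoch power_mult_distrib power_one_over mult_ac)
qed

text \<open>Each factor satisfies \<open>q^n - q^j = -q^j (1 - q^(n-j))\<close>. This is the
  classical formula for \<open>(q^(-n); q)_k\<close>, cleared of negative powers of
  \<open>q\<close>.\<close>

lemma hpoch_power_1:
  assumes "k \<le> n"
  shows "hpoch (q^n) 1 q k * qpoch q q (n - k) = hpoch 0 1 q k * qpoch q q n"
  using assms
proof (induction k)
  case (Suc k)
  obtain i where i: "n = Suc (k + i)"
    using Suc.prems by (metis Suc_le_eq less_iff_Suc_add)
  have "hpoch (q^n) 1 q (Suc k) * qpoch q q i
      = - (q^k) * (hpoch (q^n) 1 q k * (qpoch q q i * (1 - q * q^i)))"
    by (simp add: hpoch_Suc i power_add algebra_simps)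
  also have "\<dots> = - (q^k) * (hpoch (q^n) 1 q k * qpoch q q (n - k))"
    by (simp add: i Suc_diff_le qpoch_Suc)
  finally show ?case
    using Suc by (simp add: i hpoch_Suc)
qed simp

text \<open>
  The \<open>\<^sub>6\<phi>\<^sub>5\<close> sum with parameters \<open>d = qa/y\<close>, \<open>q\<^sup>-\<^sup>n\<close>, \<open>q\<^sup>-\<^sup>l\<close>.  Written symmetrically in \<open>n\<close> and \<open>l\<close> it only
  needs \<open>(qa; q)\<^sub>n\<^sub>+\<^sub>l \<noteq> 0\<close>: one may assume \<open>l \<le> n\<close>, so that \<open>2 l \<le> n + l\<close>.
\<close>

lemma product_expansion:
  fixes a y q :: complex
  assumes "qpoch q q n \<noteq> 0" "qpoch q q l \<noteq> 0" "qpoch y q n \<noteq> 0" "qpoch y q l \<noteq> 0"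
    and "qpoch (a*q) q (n + l) \<noteq> 0"
  shows "qpoch y q (n + l) / (qpoch q q n * qpoch q q l * qpoch y q n * qpoch y q l * qpoch (a*q) q (n + l))
    = (\<Sum>m\<le>min n l. vwp a q m * hpoch y (a*q) q m * (hpoch 0 1 q m)\<^sup>2 / (qpoch q q m * qpoch y q m)
         / (qpoch q q (n - m) * qpoch (a*q) q (n + m) * qpoch q q (l - m) * qpoch (a*q) q (l + m)))"
  using assms
proof (induction n l rule: linorder_wlog)
  case (sym l n)
  then show ?case
    by (simp add: mult_ac add.commute min.commute)
next
  case (le l n)
  have split: "qpoch (a*q) q (n + k) = qpoch (a*q) q n * qpoch (a*q*q^n) q k"
       "qpoch y q (n + k) = qpoch y q n * qpoch (y*q^n) q k" for k
    by (rule qpoch_add)+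
  have nz: "qpoch (a*q) q n \<noteq> 0" "qpoch (a*q*q^n) q l \<noteq> 0"
    using le(6) split(1)[of l] by (auto simp: add.commute)
  have aq: "qpoch (a*q) q (2 * l) \<noteq> 0"
    using le(1,6) qpoch_nonzero_mono[of "a*q" q "l + n" "2 * l"] by simp
  have "qpoch y q (l + n) / (qpoch q q l * qpoch q q n * qpoch y q l * qpoch y q n * qpoch (a*q) q (l + n))
      = qpoch (y*q^n) q l / (qpoch q q l * qpoch y q l * qpoch (a*q*q^n) q l) / (qpoch q q n * qpoch (a*q) q n)"
    using le(5) by (simp add: add.commute[of l] split)
  \<comment> \<open>With \<open>r = 0\<close> the products in \<open>BCpr\<close>,
    \<open>Cpr\<close> and \<open>Bqr\<close> become 1; \<open>p = q^n\<close> stands for the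
    parameter \<open>q^(-n)\<close>, and the length \<open>l\<close> for
    \<open>q^(-l)\<close>.\<close>
  also have "qpoch (y*q^n) q l / (qpoch q q l * qpoch y q l * qpoch (a*q*q^n) q l)
     = (\<Sum>m\<le>l. vwp a q m * (hpoch y (a*q) q m * hpoch (q^n) 1 q m * hpoch 0 1 q m)
         / (qpoch q q m * qpoch y q m * qpoch (a*q*q^n) q m) / (qpoch q q (l - m) * qpoch (a*q) q (l + m)))"
    using jackson_sum_generic[of q l y a "q^n" 0] le nz aq by simp
  also have "\<dots> / (qpoch q q n * qpoch (a*q) q n)
      = (\<Sum>m\<le>min l n. vwp a q m * hpoch y (a*q) q m * (hpoch 0 1 q m)\<^sup>2 / (qpoch q q m * qpoch y q m)
         / (qpoch q q (l - m) * qpoch (a*q) q (l + m) * qpoch q q (n - m) * qpoch (a*q) q (n + m)))"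
    unfolding sum_divide_distrib
  proof (intro sum.cong)
    fix m assume "m \<in> {..min l n}"
    then have m: "m \<le> l" "m \<le> n" by auto
    have "qpoch q q (n - m) \<noteq> 0"
      using le(3) by (rule qpoch_nonzero_mono) simp
    \<comment> \<open>Symmetry in \<open>n\<close> and \<open>l\<close> is restored here:
      \<open>hpoch (q^n) 1 q m\<close> supplies the second factor \<open>hpoch 0 1 q m\<close>
      together with \<open>(q; q)_(n-m)\<close>.\<close>
    then have "hpoch (q^n) 1 q m / qpoch q q n = hpoch 0 1 q m / qpoch q q (n - m)"
      using hpoch_power_1[OF m(2), of q] le(3) by (simp add: divide_simps)
    then show "vwp a q m * (hpoch y (a*q) q m * hpoch (q^n) 1 q m * hpoch 0 1 q m)
         / (qpoch q q m * qpoch y q m * qpoch (a*q*q^n) q m) / (qpoch q q (l - m) * qpoch (a*q) q (l + m))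
         / (qpoch q q n * qpoch (a*q) q n)
       = vwp a q m * hpoch y (a*q) q m * (hpoch 0 1 q m)\<^sup>2 / (qpoch q q m * qpoch y q m)
         / (qpoch q q (l - m) * qpoch (a*q) q (l + m) * qpoch q q (n - m) * qpoch (a*q) q (n + m))"
      unfolding split by (simp add: power2_eq_square)  (simp add: divide_inverse mult_ac)
  qed (use le(1) in auto)
  finally show ?case .
qed

section \<open>Reversal of q-shifted factorials\<close>

lemma qpoch_reverse:
  assumes "y \<noteq> 0" "q \<noteq> 0"
  shows "qpoch y q n = y ^ n * hpoch 0 1 q n * qpoch (q / (y * q ^ n)) q n"
proof -
  \<comment> \<open>Since \<open>1 - y q^j = -y q^j (1 - 1/(y q^j))\<close>, the factors
    \<open>1 - 1/(y q^j)\<close> have to be recognised as those of the reversed product, taken in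
    opposite order.\<close>
  have "q / (y * q ^ n) * q ^ (n - Suc j) = 1 / (y * q ^ j)" if "j < n" for j
  proof -
    have "q ^ n = q ^ j * q * q ^ (n - Suc j)"
      using that by (metis Suc_leI le_add_diff_inverse power_add power_Suc2)
    then show ?thesis using assms by simp
  qed
  then have "qpoch (q / (y * q ^ n)) q n = (\<Prod>j<n. 1 - 1 / (y * q ^ j))"
    unfolding qpoch_def by (subst prod.nat_diff_reindex[symmetric]) simp
  then have "y ^ n * hpoch 0 1 q n * qpoch (q / (y * q ^ n)) q n
      = (\<Prod>j<n. y * (0 - 1 * q ^ j) * (1 - 1 / (y * q ^ j)))"
    by (simp only: hpoch_def prod.distrib prod_constant card_lessThan)
  also have "\<dots> = qpoch y q n"
    unfolding qpoch_def using assms by (intro prod.cong) (simp_all add: field_simps)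
  finally show ?thesis ..
qed

text \<open>Only the last \<open>m\<close> factors are reversed. For \<open>x = q\<close> this
  expresses \<open>(q; q)_N / (q; q)_(N-m)\<close> through \<open>(q^(-N); q)_m\<close>.\<close>

lemma qpoch_split_reverse:
  assumes "x \<noteq> 0" "q \<noteq> 0" "m \<le> N"
  shows "qpoch x q N = qpoch x q (N - m) * (x ^ m * (q ^ (N - m)) ^ m * hpoch 0 1 q m * qpoch (q / (x * q ^ N)) q m)"
proof -
  have "q ^ (N - m) * q ^ m = q ^ N"
    using assms by (simp add: power_add[symmetric])
  then show ?thesis
    using assms qpoch_add[of x q "N - m" m] qpoch_reverse[of "x * q^(N - m)" q m]
    by (simp add: power_mult_distrib mult.assoc)
qed

text \<open>The product \<open>(q/(x q^n); q)_(M+n)\<close> is split after \<open>M\<close> and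
  after \<open>n\<close> factors, and the two blocks of length \<open>n\<close> are
  reversed.\<close>

lemma qpoch_exchange:
  assumes "x \<noteq> 0" "q \<noteq> 0"
  shows "q ^ (M * n) * qpoch (q / (x * q ^ n)) q M * qpoch (x / q ^ M) q n = qpoch x q n * qpoch (q / x) q M"
proof -
  have "qpoch (q / (x * q ^ n)) q M * qpoch (q / (x * q ^ n) * q ^ M) q n
      = qpoch (q / (x * q ^ n)) q n * qpoch (q / x) q M"
    using qpoch_add[of "q / (x * q ^ n)" q M n] qpoch_add[of "q / (x * q ^ n)" q n M] assms
    by (simp add: add.commute)
  moreover have "qpoch (x / q ^ M) q n = (x / q ^ M) ^ n * hpoch 0 1 q n * qpoch (q / (x * q ^ n) * q ^ M) q n"
    using qpoch_reverse[of "x / q^M" q n] assms by simp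
  moreover have "qpoch x q n = x ^ n * hpoch 0 1 q n * qpoch (q / (x * q ^ n)) q n"
    using qpoch_reverse assms by blast
  ultimately show ?thesis
    using assms by (simp add: power_divide power_mult mult_ac)
qed

section \<open>The sums over \<open>l\<close> and \<open>n\<close>\<close>

text \<open>Reversing both \<open>(q; q)_N\<close> and \<open>(x; q)_N\<close> produces the same
  factor \<open>K\<close>, which cancels. This brings terminating series into the form with lengths
  \<open>N - n\<close> used in the summations above.\<close>

lemma qpoch_reversal_ratio:
  assumes "x \<noteq> 0" "q \<noteq> 0" "n \<le> N" "qpoch q q N \<noteq> 0" "qpoch x q N \<noteq> 0"
  shows "qpoch (1 / q ^ N) q n * q ^ n / qpoch (q / (x * q ^ N)) q n
    = qpoch q q N * qpoch x q (N - n) * x ^ n / (qpoch q q (N - n) * qpoch x q N)"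
proof -
  define K where "K = (q ^ (N - n)) ^ n * hpoch 0 1 q n"
  have 1: "qpoch q q N = qpoch q q (N - n) * (q ^ n * K * qpoch (1 / q ^ N) q n)"
    using qpoch_split_reverse[of q q n N] assms by (simp add: K_def mult_ac)
  have 2: "qpoch x q N = qpoch x q (N - n) * (x ^ n * K * qpoch (q / (x * q ^ N)) q n)"
    using qpoch_split_reverse[of x q n N] assms by (simp add: K_def mult_ac)
  have "qpoch q q (N - n) \<noteq> 0" "K \<noteq> 0" "qpoch x q (N - n) \<noteq> 0" "qpoch (q / (x * q ^ N)) q n \<noteq> 0"
    using 1 2 assms by auto
  then show ?thesis
    unfolding 1 2 using assms by (simp add: divide_simps)
qed

text \<open>The last \<open>M\<close> factors of \<open>(h/q^M; q)_(n+M)\<close> are, up to nonzero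
  monomials, those of \<open>(q/(h q^n); q)_M\<close> in reverse order. So this denominator, which
  the sum over \<open>l\<close> creates, inherits its nonvanishing from one in the double
  sum.\<close>

lemma qpoch_reversed_nonzero:
  assumes "h \<noteq> 0" "q \<noteq> 0" "qpoch (h / q ^ M) q (n + M) \<noteq> 0"
  shows "qpoch (q / (h * q ^ n)) q M \<noteq> 0"
proof -
  have "h / q ^ M * q ^ n = q / (q / (h * q ^ n) * q ^ M)"
    using assms by simp
  then have "qpoch (q / (q / (h * q ^ n) * q ^ M)) q M \<noteq> 0"
    using assms(3) by (metis mult_eq_0_iff qpoch_add)
  then show ?thesis
    using assms qpoch_split_reverse[of "q / (h * q ^ n)" q M M] hpoch_0_1_nonzero by auto
qed

lemma sum_shift_lower:
  fixes f :: "nat \<Rightarrow> 'a::comm_monoid_add"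
  assumes "m \<le> N"
  shows "(\<Sum>n=m..N. f n) = (\<Sum>k\<le>N - m. f (m + k))"
  using sum.shift_bounds_cl_nat_ivl[of f 0 m "N - m"] assms
  by (simp add: atMost_atLeast0 add.commute)

text \<open>The shift \<open>l = m + k\<close> gives a q-Saalschuetz sum of length
  \<open>M - m\<close> with parameters \<open>c q^m\<close> and \<open>e q^(n+m)\<close>. Reversing
  the quotient of \<open>(q^(-M); q)_l\<close> by the last \<open>l\<close> factors of
  \<open>(ec/(a q^M); q)_(n+l)\<close> forces this \<open>u\<close>; then
  \<open>A D u = q a q^(2m)\<close>, which matches the tail of \<open>(qa; q)_(l+m)\<close>.\<close>

lemma inner_sum:
  fixes a c e q u :: complex and n M m :: nat
  defines "u \<equiv> q * a / (e * c * q ^ n)"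
  assumes nz: "q \<noteq> 0" "a \<noteq> 0" "c \<noteq> 0" "e \<noteq> 0" and m: "m \<le> M"
    and qM: "qpoch q q M \<noteq> 0" and aq: "qpoch (q * a) q (M + m) \<noteq> 0"
    and h: "qpoch (e * c / a / q ^ M) q (n + M) \<noteq> 0"
  shows "(\<Sum>l=m..M. qpoch e q (n + l) * qpoch c q l * qpoch (1 / q ^ M) q l * q ^ l
      / (qpoch (e * c / a / q ^ M) q (n + l) * qpoch q q (l - m) * qpoch (q * a) q (l + m)))
    = qpoch e q (n + m) * qpoch c q m * qpoch q q M * u ^ m
        * qpoch (q * a / c * q ^ m) q (M - m) * qpoch (q * a * q ^ m / (e * q ^ n)) q (M - m)
      / (qpoch (e * c / a / q ^ M) q n * qpoch u q M * qpoch q q (M - m) * qpoch (q * a) q (M + m))"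
    (is "?L = _")
proof -
  have u0: "u \<noteq> 0" using nz by (simp add: u_def)
  have hu: "e * c / a / q ^ M * q ^ n = q / (u * q ^ M)"
    using nz by (simp add: u_def)
  have h_split: "qpoch (e * c / a / q ^ M) q (n + l) = qpoch (e * c / a / q ^ M) q n * qpoch (q / (u * q ^ M)) q l" for l
    by (simp only: qpoch_add hu)
  have uM: "qpoch u q M \<noteq> 0"
    using qpoch_reversed_nonzero[of "e * c / a" q M n] h nz by (simp add: u_def mult_ac)
  have prod: "c * q ^ m * (e * q ^ (n + m)) * u = q * a * q ^ (2 * m)"
    using nz by (simp add: u_def power_add mult_2)
  define P where "P = qpoch e q (n + m) * qpoch c q m * qpoch q q M * u ^ m
          / (qpoch (e * c / a / q ^ M) q n * qpoch u q M * qpoch (q * a) q (2 * m))"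
  define S where "S k = qpoch (c * q ^ m) q k * qpoch (e * q ^ (n + m)) q k * u ^ k * qpoch u q (M - m - k)
            / (qpoch q q k * qpoch (c * q ^ m * (e * q ^ (n + m)) * u) q k * qpoch q q (M - m - k))" for k
  have summand: "qpoch e q (n + (m + k)) * qpoch c q (m + k) * qpoch (1 / q ^ M) q (m + k) * q ^ (m + k)
        / (qpoch (e * c / a / q ^ M) q (n + (m + k)) * qpoch q q (m + k - m) * qpoch (q * a) q (m + k + m))
      = P * S k"
    if "k \<in> {..M - m}" for k
  proof -
    have "qpoch (1 / q ^ M) q (m + k) * q ^ (m + k) / qpoch (q / (u * q ^ M)) q (m + k)
        = qpoch q q M * qpoch u q (M - (m + k)) * u ^ (m + k) / (qpoch q q (M - (m + k)) * qpoch u q M)"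
      using u0 nz qM uM that m by (intro qpoch_reversal_ratio) auto
    moreover have "qpoch e q (n + (m + k)) = qpoch e q (n + m) * qpoch (e * q ^ (n + m)) q k"
      by (metis add.assoc qpoch_add)
    moreover have "qpoch (q * a) q (m + k + m) = qpoch (q * a) q (2 * m) * qpoch (q * a * q ^ (2 * m)) q k"
      using qpoch_add[of "q * a" q "2 * m" k] by (simp add: mult_2 add_ac)
    ultimately show ?thesis
      unfolding h_split P_def S_def prod
      by (simp add: qpoch_add[of c] power_add divide_inverse) (simp add: mult_ac)
  qed
  have aq2: "qpoch (q * a) q (M + m) = qpoch (q * a) q (2 * m) * qpoch (q * a * q ^ (2 * m)) q (M - m)"
    using qpoch_add[of "q * a" q "2 * m" "M - m"] m by (simp add: mult_2 add_ac)
  have S: "(\<Sum>k\<le>M - m. S k)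
      = qpoch (c * q ^ m * u) q (M - m) * qpoch (e * q ^ (n + m) * u) q (M - m)
        / (qpoch q q (M - m) * qpoch (c * q ^ m * (e * q ^ (n + m)) * u) q (M - m))"
    unfolding S_def
    using nz aq aq2 qpoch_nonzero_mono[OF qM, of "M - m"] by (intro q_saalschuetz_sum) (auto simp: prod)
  have cu: "c * q ^ m * u = q * a * q ^ m / (e * q ^ n)" "e * q ^ (n + m) * u = q * a / c * q ^ m"
    using nz by (simp_all add: u_def power_add)
  have "?L = (\<Sum>k\<le>M - m. P * S k)"
    unfolding sum_shift_lower[OF m] by (rule sum.cong[OF refl summand])
  also have "\<dots> = P * (\<Sum>k\<le>M - m. S k)"
    by (simp only: sum_distrib_left)
  finally show ?thesis
    unfolding S cu prod P_def aq2 by (simp add: mult_ac)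
qed

text \<open>After the shift \<open>n = m + k\<close> and two applications of
  \<open>qpoch_exchange\<close>, this is Jackson's sum of length \<open>N - m\<close> with base
  \<open>e q^(2m)\<close>.\<close>

lemma outer_sum:
  fixes a b c e f g h q w :: complex and N :: nat
  defines "f \<equiv> a * e * q ^ (1 + N) / (b * c)" and "w \<equiv> q * a / (b * c)" and "g \<equiv> e / a"
  assumes nz: "q \<noteq> 0" "a \<noteq> 0" "b \<noteq> 0" "c \<noteq> 0" "e \<noteq> 0" "h \<noteq> 0" and m: "m \<le> M" "m \<le> N"
    and qN: "qpoch q q N \<noteq> 0" and aq: "qpoch (q * a) q (N + m) \<noteq> 0"
    and wN: "qpoch w q N \<noteq> 0"
    and eb: "qpoch (q * e / b) q N \<noteq> 0" and ec: "qpoch (q * e / c) q N \<noteq> 0"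
    and eN: "qpoch (e * q ^ (1 + N)) q N \<noteq> 0"
    and hM: "qpoch (q / h) q M \<noteq> 0"
    and hn: "\<And>n. n \<le> N \<Longrightarrow> qpoch (h / q ^ M) q n * qpoch (q / (h * q ^ n)) q M \<noteq> 0"
  shows "(\<Sum>n=m..N. vwp (e * q ^ (2 * m)) q (n - m)
        * (qpoch b q n * qpoch c q n * qpoch f q n * qpoch h q n * qpoch (g / q ^ M) q n * qpoch (1 / q ^ N) q n * q ^ n)
        / (qpoch (q * e / b) q n * qpoch (q * e / c) q n * qpoch (q / (w * q ^ N)) q n * qpoch (e * q ^ (1 + N)) q n)
        * ((q / (h * q ^ n)) ^ m * qpoch (q * q ^ m / (g * q ^ n)) q (M - m)
          / (qpoch (h / q ^ M) q n * qpoch (q / (h * q ^ n)) q M))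
        / (qpoch q q (n - m) * qpoch (q * a) q (n + m)))
    = qpoch b q m * qpoch c q m * qpoch f q m
        / (qpoch (q * e / b) q m * qpoch (q * e / c) q m * qpoch (e * q ^ (1 + N)) q m * qpoch (q * a) q (2 * m))
      * (qpoch q q N * w ^ m / qpoch w q N) * (q ^ (M * m) / qpoch (q / h) q M)
      * (q / (h * q ^ m)) ^ m * (qpoch (g / q ^ M) q m * qpoch (q / g) q (M - m))
      * (qpoch (q * e * q ^ (2 * m)) q (N - m) * qpoch (q * e / (b * c)) q (N - m)
          * qpoch (q * a / b * q ^ m) q (N - m) * qpoch (q * a / c * q ^ m) q (N - m)
        / (qpoch q q (N - m) * qpoch (q * a * q ^ (2 * m)) q (N - m)
          * qpoch (q * e / b * q ^ m) q (N - m) * qpoch (q * e / c * q ^ m) q (N - m)))"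
    (is "?L = _")
proof -
  \<comment> \<open>\<open>1/p\<close> and \<open>1/r\<close> are \<open>b\<close> and
    \<open>c\<close> shifted by \<open>q^m\<close>, the third parameter \<open>Bq/C\<close> is
    \<open>g\<close>, and the choice of \<open>f\<close> makes the balanced parameter
    \<open>f q^m\<close>.\<close>
  define B C p r where "B = e * q ^ (2 * m)" and "C = q * a * q ^ (2 * m)"
    and "p = 1 / (b * q ^ m)" and "r = 1 / (c * q ^ m)"
  define K where "K = N - m"
  have N: "N = m + K" using m by (simp add: K_def)
  have nz': "B \<noteq> 0" "C \<noteq> 0" "p \<noteq> 0" "r \<noteq> 0" "w \<noteq> 0" "g \<noteq> 0"
    using nz by (simp_all add: B_def C_def p_def r_def w_def g_def)
  have q2: "q ^ (2 * m) = q ^ m * q ^ m"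
    by (simp add: mult_2 power_add)
  have eqs: "B * q * p = q * e / b * q ^ m" "B * q * r = q * e / c * q ^ m" "C * p * r = w"
      "B * q * p * r = q * e / (b * c)" "C * p = q * a / b * q ^ m" "C * r = q * a / c * q ^ m"
      "B * q * q ^ K = e * q ^ (1 + N) * q ^ m" "B * C * p * r * q ^ K = f * q ^ m" "B * q = q * e * q ^ (2 * m)"
    unfolding B_def C_def p_def r_def w_def f_def q2 N using nz by (simp_all add: power_add field_simps)
  define F where "F = qpoch b q m * qpoch c q m * qpoch f q m
        / (qpoch (q * e / b) q m * qpoch (q * e / c) q m * qpoch (e * q ^ (1 + N)) q m * qpoch (q * a) q (2 * m))
      * (qpoch q q N * w ^ m / qpoch w q N) * (q ^ (M * m) / qpoch (q / h) q M)
      * (q / (h * q ^ m)) ^ m * (qpoch (g / q ^ M) q m * qpoch (q / g) q (M - m))"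
  define J where "J k = vwp B q k * (hpoch C (B*q) q k * hpoch p 1 q k * hpoch r 1 q k)
            / (qpoch q q k * qpoch C q k * qpoch (B*q*p) q k * qpoch (B*q*r) q k)
            * (qpoch (B*C*p*r*q^K) q k * qpoch (C*p*r) q (K - k)
               / (qpoch q q (K - k) * qpoch (B*q*q^K) q k))" for k
  have aq2: "qpoch (q * a) q (m + k + m) = qpoch (q * a) q (2 * m) * qpoch C q k" for k
    using qpoch_add[of "q * a" q "2 * m" k] by (simp add: C_def mult_2 add_ac)
  have summand: "vwp (e * q ^ (2 * m)) q (m + k - m)
        * (qpoch b q (m + k) * qpoch c q (m + k) * qpoch f q (m + k) * qpoch h q (m + k) * qpoch (g / q ^ M) q (m + k) * qpoch (1 / q ^ N) q (m + k) * q ^ (m + k))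
        / (qpoch (q * e / b) q (m + k) * qpoch (q * e / c) q (m + k) * qpoch (q / (w * q ^ N)) q (m + k) * qpoch (e * q ^ (1 + N)) q (m + k))
        * ((q / (h * q ^ (m + k))) ^ m * qpoch (q * q ^ m / (g * q ^ (m + k))) q (M - m)
          / (qpoch (h / q ^ M) q (m + k) * qpoch (q / (h * q ^ (m + k))) q M))
        / (qpoch q q (m + k - m) * qpoch (q * a) q (m + k + m)) = F * J k"
    if "k \<in> {..K}" for k
  proof -
    have k: "k \<le> K" using that by simp
    define n where "n = m + k"
    have n: "n \<le> N" using k by (simp add: n_def N)
    have T1: "qpoch (1 / q ^ N) q n * q ^ n / qpoch (q / (w * q ^ N)) q n
        = qpoch q q N * qpoch w q (K - k) * (w ^ m * w ^ k) / (qpoch q q (K - k) * qpoch w q N)"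
      using qpoch_reversal_ratio[of w q n N] nz nz' n qN wN by (simp add: n_def N power_add)
    \<comment> \<open>The dependence on \<open>n\<close> collapses to a power of \<open>q\<close>:
      \<open>h/q^M\<close> and \<open>q/(h q^n)\<close> are exchanged for \<open>h\<close>, which
      cancels, and \<open>q/h\<close>.\<close>
    have T2: "qpoch h q n / (qpoch (h / q ^ M) q n * qpoch (q / (h * q ^ n)) q M)
        = q ^ (M * m) * q ^ (M * k) / qpoch (q / h) q M"
      using qpoch_exchange[of h q M n] nz hn[OF n] hM
      by (simp add: n_def power_add add_mult_distrib2 divide_simps mult_ac)
    have T3: "qpoch (g / q ^ M) q n * qpoch (q * q ^ m / (g * q ^ n)) q (M - m)
        = qpoch (g / q ^ M) q m * qpoch (q / g) q (M - m) * (qpoch g q k / q ^ ((M - m) * k))"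
    proof -
      have "g / q ^ M * q ^ m = g / q ^ (M - m)"
        using nz m by (simp add: power_diff)
      then have t1: "qpoch (g / q ^ M) q n = qpoch (g / q ^ M) q m * qpoch (g / q ^ (M - m)) q k"
        by (simp add: n_def qpoch_add)
      have t2: "q * q ^ m / (g * q ^ n) = q / (g * q ^ k)"
        using nz by (simp add: n_def power_add)
      show ?thesis
        unfolding t1 t2 using qpoch_exchange[of g q "M - m" k] nz nz' by (simp add: field_simps)
    qed
    have T4: "(q / (h * q ^ n)) ^ m = (q / (h * q ^ m)) ^ m / q ^ (m * k)"
      by (simp add: n_def power_divide power_mult_distrib power_add power_mult[symmetric] mult.commute)
    \<comment> \<open>The powers of \<open>q\<close> that depend on \<open>k\<close> in
      \<open>T2\<close>, \<open>T3\<close> and \<open>T4\<close> have exponents \<open>Mk\<close>,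
      \<open>-(M-m)k\<close> and \<open>-mk\<close>, so they cancel.\<close>
    have T5: "q ^ (M * k) = q ^ ((M - m) * k) * q ^ (m * k)"
      using m by (simp add: power_add[symmetric] add_mult_distrib[symmetric])
    have hp: "hpoch C (B * q) q k = C ^ k * qpoch g q k" "hpoch p 1 q k = p ^ k * qpoch (b * q ^ m) q k"
        "hpoch r 1 q k = r ^ k * qpoch (c * q ^ m) q k"
      using nz nz' by (auto simp: hpoch_eq_qpoch B_def C_def g_def p_def r_def)
    have wk: "w ^ k = C ^ k * p ^ k * r ^ k"
      by (simp add: eqs(3)[symmetric] power_mult_distrib)
    define X where "X = vwp B q k * (qpoch b q n * qpoch c q n * qpoch f q n)
        / (qpoch (q * e / b) q n * qpoch (q * e / c) q n * qpoch (e * q ^ (1 + N)) q n)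
        / (qpoch q q k * qpoch (q * a) q (n + m))"
    have "vwp (e * q ^ (2 * m)) q (n - m)
        * (qpoch b q n * qpoch c q n * qpoch f q n * qpoch h q n * qpoch (g / q ^ M) q n * qpoch (1 / q ^ N) q n * q ^ n)
        / (qpoch (q * e / b) q n * qpoch (q * e / c) q n * qpoch (q / (w * q ^ N)) q n * qpoch (e * q ^ (1 + N)) q n)
        * ((q / (h * q ^ n)) ^ m * qpoch (q * q ^ m / (g * q ^ n)) q (M - m)
          / (qpoch (h / q ^ M) q n * qpoch (q / (h * q ^ n)) q M))
        / (qpoch q q (n - m) * qpoch (q * a) q (n + m))
      = X * (qpoch (1 / q ^ N) q n * q ^ n / qpoch (q / (w * q ^ N)) q n)
        * (qpoch h q n / (qpoch (h / q ^ M) q n * qpoch (q / (h * q ^ n)) q M))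
        * (qpoch (g / q ^ M) q n * qpoch (q * q ^ m / (g * q ^ n)) q (M - m))
        * (q / (h * q ^ n)) ^ m"
      unfolding X_def B_def by (simp add: n_def divide_inverse mult_ac)
    also have "\<dots> = X * (qpoch q q N * qpoch w q (K - k) * (w ^ m * w ^ k) / (qpoch q q (K - k) * qpoch w q N))
        * (q ^ (M * m) / qpoch (q / h) q M)
        * (qpoch (g / q ^ M) q m * qpoch (q / g) q (M - m) * qpoch g q k) * (q / (h * q ^ m)) ^ m"
      unfolding T1 T2 T3 T4 T5 using nz by (simp add: mult_ac)
    also have "\<dots> = F * J k"
      unfolding X_def F_def J_def hp wk n_def aq2 eqs(1,2,3,7,8) by (simp add: qpoch_add divide_inverse mult_ac)
    finally show ?thesis unfolding n_def .
  qed
  have "(\<Sum>k\<le>K. J k) = qpoch (B*q) q K * qpoch (B*q*p*r) q K * qpoch (C*p) q K * qpoch (C*r) q K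
            / (qpoch q q K * qpoch C q K * qpoch (B*q*p) q K * qpoch (B*q*r) q K)"
    unfolding J_def
  \<comment> \<open>The generic form does not apply: of \<open>(Bq; q)_(2K)\<close> only the upper
    half \<open>(B q q^K; q)_K\<close> is known to be nonzero.\<close>
  proof (rule jackson_sum)
    show "qpoch q q K \<noteq> 0"
      using qN by (rule qpoch_nonzero_mono) (simp add: K_def)
    show "qpoch C q K \<noteq> 0"
      using aq aq2[of K] N by auto
  qed (unfold eqs(1,2,7), unfold K_def, (rule qpoch_nonzero_shift, fact, use m in simp)+)
  note J_sum = this[unfolded eqs(4), unfolded eqs(1,2,5,6), unfolded eqs(9)]
  have "?L = (\<Sum>k\<le>K. F * J k)"
    unfolding sum_shift_lower[OF m(2)] K_def[symmetric] by (rule sum.cong[OF refl summand])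
  also have "\<dots> = F * (\<Sum>k\<le>K. J k)"
    by (simp only: sum_distrib_left)
  finally show ?thesis
    unfolding J_sum unfolding F_def C_def K_def .
qed

section \<open>The transformation\<close>

lemma qpoch_self_nonzero: "norm q < 1 \<Longrightarrow> qpoch q q n \<noteq> 0"
proof (induction n)
  case (Suc n)
  have "norm (q * q ^ n) \<le> norm q * 1"
    unfolding norm_mult norm_power using Suc.prems by (intro mult_left_mono power_le_one) auto
  then have "q * q ^ n \<noteq> 1"
    using Suc.prems by auto
  with Suc show ?case by (simp add: qpoch_Suc)
qed simp

lemma qpoch_inverse_power_eq_0: "q \<noteq> 0 \<Longrightarrow> M < m \<Longrightarrow> qpoch (1 / q ^ M) q m = 0"
  by (auto simp: qpoch_def)

text \<open>The exponents add up as \<open>m(m-1) + m = m^2\<close>. This absorbs the squared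
  \<open>hpoch 0 1 q m\<close> of the expansion into pure \<open>m\<close>-th powers.\<close>

lemma hpoch_0_1_square: "(hpoch 0 1 q m)\<^sup>2 * q ^ m = (q ^ m) ^ m"
proof (induction m)
  case (Suc m)
  have "(hpoch 0 1 q (Suc m))\<^sup>2 * q ^ Suc m = ((hpoch 0 1 q m)\<^sup>2 * q ^ m) * (q ^ m * q ^ m * q)"
    by (simp add: hpoch_Suc power2_eq_square)
  also have "\<dots> = (q ^ Suc m) ^ Suc m"
    unfolding Suc.IH by (simp add: power_mult_distrib mult_ac)
  finally show ?case .
qed simp

text \<open>Both sides are \<open>(x; q)_(n+1)\<close>, split at the first and at the last
  factor.\<close>

lemma qpoch_mult_one_minus: "qpoch (q * x) q n * (1 - x) = qpoch x q n * (1 - x * q ^ n)"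
  using qpoch_add[of x q 1 n] by (simp add: qpoch_Suc[symmetric] qpoch_Suc[of x q 0, simplified] mult.commute)

text \<open>The quotient with square roots is \<open>(1 - e q^(2n)) / (1 - e)\<close>, whose
  denominator cancels the first factor of \<open>(e; q)_(n+m)\<close>. Splitting off
  \<open>2m\<close> factors leaves the very-well-poised part for the base \<open>e q^(2m)\<close>
  that Jackson's sum over \<open>n\<close> requires.\<close>

lemma very_well_poised_factor:
  assumes s: "s\<^sup>2 = e" and nz: "qpoch s q n \<noteq> 0" "qpoch (- s) q n \<noteq> 0" and "m \<le> n"
  shows "qpoch e q (n + m) * (qpoch (q * s) q n * qpoch (- q * s) q n / (qpoch s q n * qpoch (- s) q n))
    = qpoch (q * e) q (2 * m) * vwp (e * q ^ (2 * m)) q (n - m)"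
proof (cases n)
  case 0
  then show ?thesis using assms by simp
next
  case (Suc n')
  have "1 - s \<noteq> 0" "1 - (- s) \<noteq> 0"
    using qpoch_nonzero_mono[of s q n 1] qpoch_nonzero_mono[of "- s" q n 1] nz Suc
    by (simp_all add: qpoch_def)
  moreover have e1: "1 - e = (1 - s) * (1 - (- s))"
    using s by (simp add: algebra_simps power2_eq_square)
  ultimately have e: "1 - e \<noteq> 0" by simp
  have "qpoch (q * s) q n * qpoch (- q * s) q n * (1 - e)
      = (qpoch (q * s) q n * (1 - s)) * (qpoch (q * (- s)) q n * (1 - (- s)))"
    by (simp add: e1 mult_ac)
  also have "\<dots> = qpoch s q n * qpoch (- s) q n * ((1 - s * q ^ n) * (1 + s * q ^ n))"
    unfolding qpoch_mult_one_minus by simp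
  also have "(1 - s * q ^ n) * (1 + s * q ^ n) = 1 - e * q ^ (2 * n)"
    by (simp add: s[symmetric] algebra_simps power2_eq_square mult_2_right power_add)
  finally have "qpoch (q * s) q n * qpoch (- q * s) q n / (qpoch s q n * qpoch (- s) q n)
      = (1 - e * q ^ (2 * n)) / (1 - e)"
    using nz e by (simp add: divide_simps mult_ac)
  moreover have "qpoch e q (n + m) = (1 - e) * qpoch (q * e) q (n' + m)"
    using qpoch_add[of e q 1 "n' + m"] Suc by (simp add: qpoch_Suc[of e q 0, simplified] mult.commute)
  ultimately have "qpoch e q (n + m) * (qpoch (q * s) q n * qpoch (- q * s) q n / (qpoch s q n * qpoch (- s) q n))
      = qpoch (q * e) q (n' + m) * (1 - e * q ^ (2 * n))"
    using e by simp
  also have "\<dots> = qpoch (q * e) q (2 * m) * vwp (e * q ^ (2 * m)) q (n - m)"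
  proof (cases "n = m")
    case True
    \<comment> \<open>Here \<open>vwp\<close> is 1, and \<open>1 - e q^(2n)\<close> is the last
      factor of \<open>(qe; q)_(2m)\<close>.\<close>
    then have "2 * m = Suc (n' + m)" using Suc by simp
    then show ?thesis using True by (simp only: qpoch_Suc) (simp add: mult_ac)
  next
    case False
    then obtain k where k: "n = m + Suc k"
      using \<open>m \<le> n\<close> by (metis le_neq_implies_less less_iff_Suc_add add_Suc_right)
    then have "n' + m = 2 * m + k" using Suc by simp
    moreover have "q ^ (2 * n) = q ^ (2 * m) * q ^ (2 * Suc k)"
      unfolding k by (simp add: power_add[symmetric])
    ultimately show ?thesis
      by (simp only: qpoch_add k vwp_Suc diff_add_inverse) (simp add: mult_ac)
  qed
  finally show ?thesis .
qed

lemma sum_triangle_swap: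
  fixes F :: "nat \<Rightarrow> nat \<Rightarrow> nat \<Rightarrow> 'a::comm_monoid_add"
  shows "(\<Sum>l=0..M. \<Sum>n=0..N. \<Sum>m\<le>min n l. F m n l) = (\<Sum>m\<le>min M N. \<Sum>n=m..N. \<Sum>l=m..M. F m n l)"
  by (simp add: sum.Sigma)
    (rule sum.reindex_bij_witness[where i = "\<lambda>(m, n, l). (l, n, m)" and j = "\<lambda>(l, n, m). (m, n, l)"], auto)

text \<open>The left side is the coefficient of the product expansion times what the sums over
  \<open>l\<close> and \<open>n\<close> evaluate to. Blocks of complementary lengths join into the
  full products of the prefactor; reversing the others yields the terminating parameters and
  \<open>(bc/(e q^N); q)_m\<close>.\<close>

lemma coefficient_identity:
  fixes a b c c' d e f h q w y g z :: complex and M N m :: nat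
  defines "f \<equiv> a * e * q ^ (1 + N) / (b * c)" and "w \<equiv> q * a / (b * c)" and "g \<equiv> e / a"
    and "h \<equiv> e * c' / a" and "y \<equiv> q * a / d" and "z \<equiv> a\<^sup>2 * q ^ (2 + M) / (e * c' * d)"
  assumes nz: "q \<noteq> 0" "a \<noteq> 0" "b \<noteq> 0" "c \<noteq> 0" "e \<noteq> 0" "c' \<noteq> 0" "d \<noteq> 0"
    and m: "m \<le> M" "m \<le> N" and q: "qpoch q q M \<noteq> 0" "qpoch q q N \<noteq> 0"
    and eN: "qpoch (e * q ^ (1 + N)) q m \<noteq> 0"
    and am: "qpoch (q * a / b) q m \<noteq> 0" "qpoch (q * a / c) q m \<noteq> 0" "qpoch (q * a / c') q m \<noteq> 0"
      "qpoch (b * c / (e * q ^ N)) q m \<noteq> 0"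
  shows "vwp a q m * hpoch y (q * a) q m * (hpoch 0 1 q m)\<^sup>2 / (qpoch q q m * qpoch y q m)
      * (qpoch c' q m * qpoch q q M * qpoch (q * a / c' * q ^ m) q (M - m)
          / (qpoch q q (M - m) * qpoch (q * a) q (M + m)))
      * qpoch (q * e) q (2 * m)
      * (qpoch b q m * qpoch c q m * qpoch f q m
        / (qpoch (q * e / b) q m * qpoch (q * e / c) q m * qpoch (e * q ^ (1 + N)) q m * qpoch (q * a) q (2 * m))
      * (qpoch q q N * w ^ m / qpoch w q N) * (q ^ (M * m) / qpoch (q / h) q M)
      * (q / (h * q ^ m)) ^ m * (qpoch (g / q ^ M) q m * qpoch (q / g) q (M - m))
      * (qpoch (q * e * q ^ (2 * m)) q (N - m) * qpoch (q * e / (b * c)) q (N - m)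
          * qpoch (q * a / b * q ^ m) q (N - m) * qpoch (q * a / c * q ^ m) q (N - m)
        / (qpoch q q (N - m) * qpoch (q * a * q ^ (2 * m)) q (N - m)
          * qpoch (q * e / b * q ^ m) q (N - m) * qpoch (q * e / c * q ^ m) q (N - m))))
    = qpoch (q * a / e) q M * qpoch (q * a / c') q M / (qpoch (q * a) q M * qpoch (q * a / (e * c')) q M)
      * (qpoch (q * e) q N * qpoch (q * a / b) q N * qpoch (q * a / c) q N * qpoch (q * e / (b * c)) q N
        / (qpoch (q * a) q N * qpoch (q * e / b) q N * qpoch (q * e / c) q N * qpoch w q N))
      * (vwp a q m / qpoch q q m
        * (qpoch d q m * qpoch b q m * qpoch c q m * qpoch c' q m * qpoch f q m
            * qpoch (1 / q ^ M) q m * qpoch (1 / q ^ N) q m)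
        / (qpoch y q m * qpoch (q * a / b) q m * qpoch (q * a / c) q m * qpoch (q * a / c') q m
            * qpoch (b * c / (e * q ^ N)) q m * qpoch (q * a * q ^ M) q m * qpoch (q * a * q ^ N) q m)
        * z ^ m)" (is "?L = ?R")
proof -
  define s where "s = hpoch 0 1 q m"
  define x where "x = q * e / (b * c)"
  have s0: "s \<noteq> 0" using nz by (simp add: s_def hpoch_0_1_nonzero)
  have nz': "y \<noteq> 0" "w \<noteq> 0" "g \<noteq> 0" "h \<noteq> 0" "x \<noteq> 0"
    using nz by (simp_all add: y_def w_def g_def h_def x_def)
  have full: "qpoch X q K = qpoch X q m * qpoch (X * q ^ m) q (K - m)" if "m \<le> K" for X K
    using qpoch_add[of X q m "K - m"] that by simp
  have double: "qpoch X q (2 * m) * qpoch (X * q ^ (2 * m)) q (K - m) = qpoch X q K * qpoch (X * q ^ K) q m"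
    if "m \<le> K" for X K
    using qpoch_add[of X q "2 * m" "K - m"] qpoch_add[of X q K m] that by (simp add: mult_2 add.commute)
  have hp: "hpoch y (q * a) q m = y ^ m * qpoch d q m"
    using nz nz' by (simp add: hpoch_eq_qpoch y_def)
  have rev: "qpoch q q K / qpoch q q (K - m) = q ^ m * (q ^ (K - m)) ^ m * s * qpoch (1 / q ^ K) q m"
    if "m \<le> K" "qpoch q q K \<noteq> 0" for K
    using qpoch_split_reverse[of q q m K] nz that qpoch_nonzero_mono[of q q K "K - m"] by (simp add: s_def)
  have g: "qpoch (g / q ^ M) q m * qpoch (q / g) q (M - m) = qpoch (q / g) q M / ((q / g) ^ m * (q ^ (M - m)) ^ m * s)"
    using qpoch_split_reverse[of "q / g" q m M] nz nz' m s0 by (simp add: s_def)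
  have x: "qpoch x q (N - m)
      = qpoch x q N / (x ^ m * (q ^ (N - m)) ^ m * s * qpoch (b * c / (e * q ^ N)) q m)"
  proof -
    have "q / (x * q ^ N) = b * c / (e * q ^ N)" using nz by (simp add: x_def)
    then show ?thesis
      using qpoch_split_reverse[of x q m N] nz nz' m s0 am by (simp add: s_def)
  qed
  \<comment> \<open>These are the monomials left over after all reversals. The factor
    \<open>s^2\<close> disappears through \<open>hpoch_0_1_square\<close>, and the base of the
    remaining \<open>m\<close>-th power is the argument \<open>z\<close> of the series.\<close>
  have mono: "y ^ m * s\<^sup>2 * w ^ m * q ^ (M * m) * (q / (h * q ^ m)) ^ m * q ^ m * q ^ m / ((q / g) ^ m * x ^ m) = z ^ m"
  proof -
    have "s\<^sup>2 * q ^ m * (q / (h * q ^ m)) ^ m = (q / h) ^ m"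
      using hpoch_0_1_square[of q m] nz by (simp add: s_def power_divide power_mult_distrib)
    then have "y ^ m * s\<^sup>2 * w ^ m * q ^ (M * m) * (q / (h * q ^ m)) ^ m * q ^ m * q ^ m / ((q / g) ^ m * x ^ m)
        = y ^ m * w ^ m * (q ^ M) ^ m * (q / h) ^ m * q ^ m / ((q / g) ^ m * x ^ m)"
      by (simp add: power_mult mult_ac)
    also have "\<dots> = (y * w * q ^ M * (q / h) * q / ((q / g) * x)) ^ m"
      by (simp add: power_mult_distrib power_divide)
    also have "y * w * q ^ M * (q / h) * q / ((q / g) * x) = z"
      using nz by (simp add: y_def w_def h_def g_def x_def z_def power2_eq_square mult_ac)
    finally show ?thesis .
  qed
  have qg: "q / g = q * a / e" "q / h = q * a / (e * c')"
    by (simp_all add: g_def h_def)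
  define P where "P = vwp a q m / qpoch q q m * (qpoch d q m / qpoch y q m)
      * (qpoch b q m * qpoch c q m * qpoch f q m * qpoch c' q m) / (qpoch w q N * qpoch (q / h) q M)"
  have "?L = P * (y ^ m * s\<^sup>2 * w ^ m * q ^ (M * m) * (q / (h * q ^ m)) ^ m)
      * (qpoch q q M / qpoch q q (M - m)) * (qpoch q q N / qpoch q q (N - m))
      * (qpoch (g / q ^ M) q m * qpoch (q / g) q (M - m)) * qpoch x q (N - m)
      * (qpoch (q * a / c' * q ^ m) q (M - m) * qpoch (q * a / b * q ^ m) q (N - m) * qpoch (q * a / c * q ^ m) q (N - m))
      * (qpoch (q * e) q (2 * m) * qpoch (q * e * q ^ (2 * m)) q (N - m) / qpoch (e * q ^ (1 + N)) q m)
      / (qpoch (q * a) q (2 * m) * qpoch (q * a * q ^ (2 * m)) q (N - m)) / qpoch (q * a) q (M + m)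
      / (qpoch (q * e / b) q m * qpoch (q * e / b * q ^ m) q (N - m))
      / (qpoch (q * e / c) q m * qpoch (q * e / c * q ^ m) q (N - m))"
    unfolding hp P_def s_def[symmetric] x_def[symmetric] by (simp add: divide_inverse mult_ac)
  also have "\<dots> = P * (y ^ m * s\<^sup>2 * w ^ m * q ^ (M * m) * (q / (h * q ^ m)) ^ m)
      * (q ^ m * (q ^ (M - m)) ^ m * s * qpoch (1 / q ^ M) q m) * (q ^ m * (q ^ (N - m)) ^ m * s * qpoch (1 / q ^ N) q m)
      * (qpoch (q / g) q M / ((q / g) ^ m * (q ^ (M - m)) ^ m * s))
      * (qpoch x q N / (x ^ m * (q ^ (N - m)) ^ m * s * qpoch (b * c / (e * q ^ N)) q m))
      * (qpoch (q * a / c') q M / qpoch (q * a / c') q m * (qpoch (q * a / b) q N / qpoch (q * a / b) q m)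
        * (qpoch (q * a / c) q N / qpoch (q * a / c) q m))
      * qpoch (q * e) q N / (qpoch (q * a) q N * qpoch (q * a * q ^ N) q m)
      / (qpoch (q * a) q M * qpoch (q * a * q ^ M) q m) / qpoch (q * e / b) q N / qpoch (q * e / c) q N"
  proof -
    have e: "qpoch (q * e) q (2 * m) * qpoch (q * e * q ^ (2 * m)) q (N - m) / qpoch (e * q ^ (1 + N)) q m = qpoch (q * e) q N"
      using double[OF m(2), of "q * e"] eN by (simp add: mult_ac)
    have quot: "qpoch (q * a / c' * q ^ m) q (M - m) = qpoch (q * a / c') q M / qpoch (q * a / c') q m"
        "qpoch (q * a / b * q ^ m) q (N - m) = qpoch (q * a / b) q N / qpoch (q * a / b) q m"
        "qpoch (q * a / c * q ^ m) q (N - m) = qpoch (q * a / c) q N / qpoch (q * a / c) q m"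
      using am by (simp_all add: full[OF m(1)] full[OF m(2)])
    show ?thesis
      unfolding e unfolding double[OF m(2)] rev[OF m(1) q(1)] rev[OF m(2) q(2)] g x qpoch_add[of "q * a" q M m] quot
        full[OF m(2), of "q * e / b", symmetric] full[OF m(2), of "q * e / c", symmetric] ..
  qed
  \<comment> \<open>Each reversal in a numerator is matched by one in a denominator, so their
    factors \<open>s\<close> and their powers of \<open>q^(M-m)\<close> and \<open>q^(N-m)\<close>
    cancel.\<close>
  also have "\<dots> = P * (y ^ m * s\<^sup>2 * w ^ m * q ^ (M * m) * (q / (h * q ^ m)) ^ m * q ^ m * q ^ m / ((q / g) ^ m * x ^ m))
      * (qpoch (1 / q ^ M) q m * qpoch (1 / q ^ N) q m)
      * qpoch (q / g) q M * qpoch x q N / qpoch (b * c / (e * q ^ N)) q m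
      * (qpoch (q * a / c') q M / qpoch (q * a / c') q m * (qpoch (q * a / b) q N / qpoch (q * a / b) q m)
        * (qpoch (q * a / c) q N / qpoch (q * a / c) q m))
      * qpoch (q * e) q N / (qpoch (q * a) q N * qpoch (q * a * q ^ N) q m)
      / (qpoch (q * a) q M * qpoch (q * a * q ^ M) q m) / qpoch (q * e / b) q N / qpoch (q * e / c) q N"
    using s0 nz by (simp add: mult_ac)
  also have "\<dots> = ?R"
    unfolding mono unfolding P_def qg x_def by (simp add: divide_inverse mult_ac)
  finally show ?thesis .
qed

section \<open>Assembly of the double sum\<close>

lemma qpochs_Nil: "qpochs [] q n = 1"
  by (simp add: qpochs_def)

lemma qpochs_Cons: "qpochs (x # xs) q n = qpoch x q n * qpochs xs q n"
  by (simp add: qpochs_def)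

theorem mainTheorem5:
  fixes M N :: nat
    and q a b c b' c' d ra rb' :: complex
  assumes "q \<noteq> 0" "a \<noteq> 0" "b \<noteq> 0" "c \<noteq> 0" "b' \<noteq> 0" "c' \<noteq> 0" "d \<noteq> 0"
    and "norm q < 1"
    and "ra\<^sup>2 = a" and "rb'\<^sup>2 = b'"
    and "\<And>l n. l \<le> M \<Longrightarrow> n \<le> N \<Longrightarrow>
           qpochs [q * a, b' * c' * q powi (- int M) / a] q (n + l) \<noteq> 0"
    and "\<And>l. l \<le> M \<Longrightarrow> qpochs [q, q * a / d] q l \<noteq> 0"
    and "\<And>n. n \<le> N \<Longrightarrow>
           qpochs [q, rb', - rb', q * b' / b, q * b' / c, b * c * q powi (- int N) / a,
                   b' * q ^ (1 + N), q * a / d] q n \<noteq> 0"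
    and "qpochs [q * a, q * a / (b' * c')] q M \<noteq> 0"
    and "qpochs [q * a, q * b' / b, q * b' / c, q * a / (b * c)] q N \<noteq> 0"
    and "\<And>m. m \<le> min M N \<Longrightarrow>
           vwp_den a ra [d, b, c, c', a * b' * q ^ (1 + N) / (b * c),
                         q powi (- int M), q powi (- int N)] q m \<noteq> 0"
  shows
    "(\<Sum>l=0..M. \<Sum>n=0..N.
        qpochs [b', q * a / d] q (n + l)
          / qpochs [q * a, b' * c' * q powi (- int M) / a] q (n + l)
        * (qpochs [c', q powi (- int M)] q l / qpochs [q, q * a / d] q l)
        * (qpochs [q * rb', - q * rb', b, c, a * b' * q ^ (1 + N) / (b * c), b' * c' / a,
                   b' * q powi (- int M) / a, q powi (- int N)] q n
           / qpochs [q, rb', - rb', q * b' / b, q * b' / c, b * c * q powi (- int N) / a,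
                     b' * q ^ (1 + N), q * a / d] q n)
        * q ^ (n + l))
     = qpochs [q * a / b', q * a / c'] q M / qpochs [q * a, q * a / (b' * c')] q M
       * (qpochs [q * b', q * a / b, q * a / c, q * b' / (b * c)] q N
          / qpochs [q * a, q * b' / b, q * b' / c, q * a / (b * c)] q N)
       * vwp_W a ra [d, b, c, c', a * b' * q ^ (1 + N) / (b * c),
                     q powi (- int M), q powi (- int N)] q
           (a\<^sup>2 * q ^ (2 + M) / (b' * c' * d))"
proof -
  define e where "e = b'"
  define f where "f = a * e * q ^ (1 + N) / (b * c)"
  define w where "w = q * a / (b * c)"
  define g where "g = e / a"
  define h where "h = e * c' / a"
  define y where "y = q * a / d"
  define z where "z = a\<^sup>2 * q ^ (2 + M) / (e * c' * d)"
  note nz = assms(1-7)[folded e_def]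
  have h0: "h \<noteq> 0" using nz by (simp add: h_def)
  have powi: "q powi (- int K) = 1 / q ^ K" for K
    by (simp add: power_int_minus divide_inverse)
  have args: "e * c' * (1 / q ^ M) / a = h / q ^ M" "e * (1 / q ^ M) / a = g / q ^ M"
    "b * c * (1 / q ^ N) / a = q / (w * q ^ N)" "q * a / f = b * c / (e * q ^ N)"
    "a * e * q ^ (1 + N) / (b * c) = f" "q * a / (1 / q ^ K) = q * a * q ^ K" "e * c' / a = h" for K
    using nz by (simp_all add: e_def f_def w_def g_def h_def)
  note expand = qpochs_Cons qpochs_Nil mult_1_right vwp_den_def vwp_num_def list.map append.simps
    e_def[symmetric] y_def[symmetric]
  have "qpoch (q * a) q (N + M) \<noteq> 0" "qpoch (h / q ^ M) q (N + M) \<noteq> 0"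
    using assms(11)[of M N, unfolded powi, unfolded expand, unfolded args] by simp_all
  then have nz1: "qpoch (q * a) q k \<noteq> 0" "qpoch (h / q ^ M) q k \<noteq> 0" if "k \<le> N + M" for k
    using qpoch_nonzero_mono[OF _ that] by blast+
  have q0: "qpoch q q k \<noteq> 0" for k
    using assms(8) by (rule qpoch_self_nonzero)
  have yl: "qpoch y q l \<noteq> 0" if "l \<le> M" for l
    using assms(12)[OF that, unfolded expand] by simp
  have nzn: "qpoch rb' q n \<noteq> 0" "qpoch (- rb') q n \<noteq> 0" "qpoch (q * e / b) q n \<noteq> 0" "qpoch (q * e / c) q n \<noteq> 0"
      "qpoch (q / (w * q ^ N)) q n \<noteq> 0" "qpoch (e * q ^ (1 + N)) q n \<noteq> 0" "qpoch y q n \<noteq> 0" if "n \<le> N" for n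
    using assms(13)[OF that, unfolded powi, unfolded expand, unfolded args] by simp_all
  have hM: "qpoch (q / h) q M \<noteq> 0"
    using assms(14) by (simp add: qpochs_Cons qpochs_Nil h_def e_def)
  have wN: "qpoch w q N \<noteq> 0"
    using assms(15) by (simp add: qpochs_Cons qpochs_Nil w_def)
  have nzm: "qpoch ra q m \<noteq> 0" "qpoch (- ra) q m \<noteq> 0" "qpoch (q * a / b) q m \<noteq> 0" "qpoch (q * a / c) q m \<noteq> 0"
      "qpoch (q * a / c') q m \<noteq> 0" "qpoch (b * c / (e * q ^ N)) q m \<noteq> 0" if "m \<le> min M N" for m
    using assms(16)[OF that, unfolded powi, unfolded expand, unfolded args] by simp_all
  \<comment> \<open>\<open>\<gamma> m\<close> is the coefficient of the product expansion.
    \<open>V\<close> and \<open>R\<close> form the \<open>n\<close>-part without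
    \<open>(q; q)_n\<close> and \<open>(qa/d; q)_n\<close>, which the expansion absorbs.
    \<open>I\<close> is the summand over \<open>l\<close>, \<open>P\<close> an \<open>n\<close>-free
    factor of its sum, \<open>T\<close> the summand over \<open>n\<close>, \<open>Q\<close> the
    prefactor and \<open>t\<close> the term of the series.\<close>
  define \<gamma> where "\<gamma> m = vwp a q m * hpoch y (q * a) q m * (hpoch 0 1 q m)\<^sup>2 / (qpoch q q m * qpoch y q m)" for m
  define V where "V n = qpoch (q * rb') q n * qpoch (- q * rb') q n / (qpoch rb' q n * qpoch (- rb') q n)" for n
  define R where "R n = (qpoch b q n * qpoch c q n * qpoch f q n * qpoch h q n * qpoch (g / q ^ M) q n * qpoch (1 / q ^ N) q n * q ^ n)
        / (qpoch (q * e / b) q n * qpoch (q * e / c) q n * qpoch (q / (w * q ^ N)) q n * qpoch (e * q ^ (1 + N)) q n)" for n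
  define I where "I m n l = qpoch e q (n + l) * qpoch c' q l * qpoch (1 / q ^ M) q l * q ^ l
      / (qpoch (h / q ^ M) q (n + l) * qpoch q q (l - m) * qpoch (q * a) q (l + m))" for m n l
  define P where "P m = qpoch c' q m * qpoch q q M * qpoch (q * a / c' * q ^ m) q (M - m)
          / (qpoch q q (M - m) * qpoch (q * a) q (M + m))" for m
  define T where "T m n = vwp (e * q ^ (2 * m)) q (n - m)
        * (qpoch b q n * qpoch c q n * qpoch f q n * qpoch h q n * qpoch (g / q ^ M) q n * qpoch (1 / q ^ N) q n * q ^ n)
        / (qpoch (q * e / b) q n * qpoch (q * e / c) q n * qpoch (q / (w * q ^ N)) q n * qpoch (e * q ^ (1 + N)) q n)
        * ((q / (h * q ^ n)) ^ m * qpoch (q * q ^ m / (g * q ^ n)) q (M - m)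
          / (qpoch (h / q ^ M) q n * qpoch (q / (h * q ^ n)) q M))
        / (qpoch q q (n - m) * qpoch (q * a) q (n + m))" for m n
  define Q where "Q = qpoch (q * a / e) q M * qpoch (q * a / c') q M / (qpoch (q * a) q M * qpoch (q * a / (e * c')) q M)
      * (qpoch (q * e) q N * qpoch (q * a / b) q N * qpoch (q * a / c) q N * qpoch (q * e / (b * c)) q N
        / (qpoch (q * a) q N * qpoch (q * e / b) q N * qpoch (q * e / c) q N * qpoch w q N))"
  define t where "t m = vwp_num a ra [d, b, c, c', f, 1 / q ^ M, 1 / q ^ N] q m
      / vwp_den a ra [d, b, c, c', f, 1 / q ^ M, 1 / q ^ N] q m * z ^ m" for m

  have summand: "qpoch e q (n + l) * qpoch y q (n + l) / (qpoch (q * a) q (n + l) * qpoch (h / q ^ M) q (n + l))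
        * (qpoch c' q l * qpoch (1 / q ^ M) q l / (qpoch q q l * qpoch y q l))
        * (qpoch (q * rb') q n * (qpoch (- q * rb') q n * (qpoch b q n * (qpoch c q n * (qpoch f q n * (qpoch h q n
              * (qpoch (g / q ^ M) q n * qpoch (1 / q ^ N) q n))))))
           / (qpoch q q n * (qpoch rb' q n * (qpoch (- rb') q n * (qpoch (q * e / b) q n * (qpoch (q * e / c) q n
              * (qpoch (q / (w * q ^ N)) q n * (qpoch (e * q ^ (1 + N)) q n * qpoch y q n))))))))
        * q ^ (n + l)
      = (\<Sum>m\<le>min n l. \<gamma> m * (V n * R n / (qpoch q q (n - m) * qpoch (q * a) q (n + m)) * I m n l))"
    if "l \<le> M" "n \<le> N" for l n
  proof -
    \<comment> \<open>Only the coupling of \<open>n\<close> and \<open>l\<close> through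
      \<open>y\<close> and \<open>qa\<close> is expanded; the couplings through \<open>e\<close> and
      \<open>h\<close> stay in \<open>I\<close> for the sum over \<open>l\<close>.\<close>
    have E: "qpoch y q (n + l) / (qpoch q q n * qpoch q q l * qpoch y q n * qpoch y q l * qpoch (q * a) q (n + l))
      = (\<Sum>m\<le>min n l. \<gamma> m / (qpoch q q (n - m) * qpoch (q * a) q (n + m) * qpoch q q (l - m) * qpoch (q * a) q (l + m)))"
      unfolding \<gamma>_def
      by (rule product_expansion[of q n l y a, unfolded mult.commute[of a q]])
        (use that q0 yl nzn nz1 in auto)
    have "(\<Sum>m\<le>min n l. \<gamma> m * (V n * R n / (qpoch q q (n - m) * qpoch (q * a) q (n + m)) * I m n l))
      = qpoch y q (n + l) / (qpoch q q n * qpoch q q l * qpoch y q n * qpoch y q l * qpoch (q * a) q (n + l))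
        * (V n * R n * (qpoch e q (n + l) * qpoch c' q l * qpoch (1 / q ^ M) q l * q ^ l / qpoch (h / q ^ M) q (n + l)))"
      unfolding E sum_distrib_right
      by (intro sum.cong refl) (simp add: I_def divide_inverse mult_ac)
    then show ?thesis
      unfolding e_def[symmetric] V_def R_def by (simp add: power_add divide_inverse mult_ac)
  qed
  have inner: "(\<Sum>l=m..M. V n * R n / (qpoch q q (n - m) * qpoch (q * a) q (n + m)) * I m n l)
      = P m * qpoch (q * e) q (2 * m) * T m n" if m: "m \<le> min M N" and n: "n \<in> {m..N}" for m n
  proof -
    have 1: "q * a / (e * c' * q ^ n) = q / (h * q ^ n)" "q * a * q ^ m / (e * q ^ n) = q * q ^ m / (g * q ^ n)"
      by (simp_all add: h_def g_def)
    \<comment> \<open>The factor \<open>(e; q)_(n+m)\<close> produced by the sum over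
      \<open>l\<close> combines with the very-well-poised quotient \<open>V n\<close>.\<close>
    have v: "qpoch e q (n + m) * V n = qpoch (q * e) q (2 * m) * vwp (e * q ^ (2 * m)) q (n - m)"
      unfolding V_def using assms(10) nzn n by (intro very_well_poised_factor) (auto simp: e_def)
    have "(\<Sum>l=m..M. I m n l) = qpoch e q (n + m) * qpoch c' q m * qpoch q q M * (q / (h * q ^ n)) ^ m
        * qpoch (q * a / c' * q ^ m) q (M - m) * qpoch (q * q ^ m / (g * q ^ n)) q (M - m)
      / (qpoch (h / q ^ M) q n * qpoch (q / (h * q ^ n)) q M * qpoch q q (M - m) * qpoch (q * a) q (M + m))"
      using inner_sum[of q a c' e m M n] nz m n q0 nz1(1)[of "M + m"] nz1(2)[of "n + M"]
      unfolding I_def h_def[symmetric] 1 by simp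
    then show ?thesis
      unfolding sum_distrib_left[symmetric]
      using v[symmetric] by (simp add: R_def P_def T_def divide_inverse mult_ac)
  qed
  have outer: "\<gamma> m * (P m * qpoch (q * e) q (2 * m) * (\<Sum>n=m..N. T m n)) = Q * t m" if m: "m \<le> min M N" for m
  proof -
    have hn: "qpoch (h / q ^ M) q n * qpoch (q / (h * q ^ n)) q M \<noteq> 0" if "n \<le> N" for n
      using nz1(2)[of n] nz1(2)[of "n + M"] that qpoch_reversed_nonzero[of h q M n] h0 nz by simp
    have tm: "t m = vwp a q m / qpoch q q m
        * (qpoch d q m * qpoch b q m * qpoch c q m * qpoch c' q m * qpoch f q m
            * qpoch (1 / q ^ M) q m * qpoch (1 / q ^ N) q m)
        / (qpoch y q m * qpoch (q * a / b) q m * qpoch (q * a / c) q m * qpoch (q * a / c') q m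
            * qpoch (b * c / (e * q ^ N)) q m * qpoch (q * a * q ^ M) q m * qpoch (q * a * q ^ N) q m)
        * z ^ m"
    proof -
      \<comment> \<open>With shift 0 the same factorization identifies the very-well-poised part of
        the series with \<open>vwp a q m\<close>.\<close>
      have "vwp a q m = qpoch a q m * (qpoch (q * ra) q m * qpoch (- q * ra) q m / (qpoch ra q m * qpoch (- ra) q m))"
        using very_well_poised_factor[of ra a q m 0] assms(9) nzm[OF m] by simp
      then show ?thesis
        unfolding t_def expand args
        by (simp add: divide_inverse mult_ac)
    qed
    have "(\<Sum>n=m..N. T m n) = qpoch b q m * qpoch c q m * qpoch f q m
        / (qpoch (q * e / b) q m * qpoch (q * e / c) q m * qpoch (e * q ^ (1 + N)) q m * qpoch (q * a) q (2 * m))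
      * (qpoch q q N * w ^ m / qpoch w q N) * (q ^ (M * m) / qpoch (q / h) q M)
      * (q / (h * q ^ m)) ^ m * (qpoch (g / q ^ M) q m * qpoch (q / g) q (M - m))
      * (qpoch (q * e * q ^ (2 * m)) q (N - m) * qpoch (q * e / (b * c)) q (N - m)
          * qpoch (q * a / b * q ^ m) q (N - m) * qpoch (q * a / c * q ^ m) q (N - m)
        / (qpoch q q (N - m) * qpoch (q * a * q ^ (2 * m)) q (N - m)
          * qpoch (q * e / b * q ^ m) q (N - m) * qpoch (q * e / c * q ^ m) q (N - m)))"
      unfolding T_def f_def w_def g_def
      by (rule outer_sum)
        (use nz h0 m q0 nz1(1)[of "N + m"] wN nzn[of N] hM hn in \<open>auto simp: w_def\<close>)
    then show ?thesis
      unfolding tm Q_def \<gamma>_def P_def f_def w_def g_def h_def y_def z_def mult.assoc[of "_ / _"]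
      using coefficient_identity[of q a b c e c' d m M N] nz m q0 nzn(6)[of m] nzm[OF m] by (simp only: mult.assoc simp_thms min.bounded_iff not_False_eq_True)
  qed
  have W: "vwp_W a ra [d, b, c, c', f, 1 / q ^ M, 1 / q ^ N] q z = (\<Sum>m\<le>min M N. t m)"
    unfolding vwp_W_def t_def[symmetric]
  proof (rule suminf_finite)
    fix m assume "m \<notin> {..min M N}"
    \<comment> \<open>Beyond \<open>min M N\<close> a numerator factor vanishes, so the term is 0
      even where its denominator vanishes too.\<close>
    then have "qpoch (1 / q ^ M) q m = 0 \<or> qpoch (1 / q ^ N) q m = 0"
      using qpoch_inverse_power_eq_0[of q] nz by auto
    then show "t m = 0"
      by (auto simp: t_def vwp_num_def qpochs_Cons)
  qed simp
  have "(\<Sum>l=0..M. \<Sum>n=0..N. \<Sum>m\<le>min n l. \<gamma> m * (V n * R n / (qpoch q q (n - m) * qpoch (q * a) q (n + m)) * I m n l))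
      = (\<Sum>m\<le>min M N. \<gamma> m * (\<Sum>n=m..N. \<Sum>l=m..M. V n * R n / (qpoch q q (n - m) * qpoch (q * a) q (n + m)) * I m n l))"
    unfolding sum_triangle_swap sum_distrib_left ..
  also have "\<dots> = (\<Sum>m\<le>min M N. Q * t m)"
  proof (rule sum.cong[OF refl])
    fix m assume "m \<in> {..min M N}"
    then have m: "m \<le> min M N" by simp
    have "(\<Sum>n=m..N. \<Sum>l=m..M. V n * R n / (qpoch q q (n - m) * qpoch (q * a) q (n + m)) * I m n l)
        = (\<Sum>n=m..N. P m * qpoch (q * e) q (2 * m) * T m n)"
      by (rule sum.cong[OF refl inner[OF m]])
    also have "\<dots> = P m * qpoch (q * e) q (2 * m) * (\<Sum>n=m..N. T m n)"
      by (simp only: sum_distrib_left)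
    finally show "\<gamma> m * (\<Sum>n=m..N. \<Sum>l=m..M. V n * R n / (qpoch q q (n - m) * qpoch (q * a) q (n + m)) * I m n l) = Q * t m"
      by (simp only: outer[OF m])
  qed
  also have "\<dots> = Q * vwp_W a ra [d, b, c, c', f, 1 / q ^ M, 1 / q ^ N] q z"
    unfolding W sum_distrib_left ..
  finally have result: "(\<Sum>l=0..M. \<Sum>n=0..N. \<Sum>m\<le>min n l. \<gamma> m * (V n * R n / (qpoch q q (n - m) * qpoch (q * a) q (n + m)) * I m n l))
      = Q * vwp_W a ra [d, b, c, c', f, 1 / q ^ M, 1 / q ^ N] q z" .
  show ?thesis
    unfolding powi unfolding expand z_def[symmetric] unfolding args
  proof (rule trans[OF _ trans[OF result]], goal_cases)
    case 1
    show ?case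
      by (intro sum.cong refl summand) auto
  next
    case 2
    show ?case
      by (simp only: Q_def w_def mult.assoc)
  qed
qed

end
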